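(* Let $d=1$ and $\mathcal L=\mathbb Z$. Suppose that for some $\varepsilon>0$ the single site potentials $W_j\in C^2(\mathbb R,\mathbb R)$, $j\in J$, obey the decay estimate $W_j'(q)=\mathcal O\bigl(|J|^{-(4+\varepsilon)|q|}\bigr)$. Then $$\lambda^1\bigl(\overline{\mathrm{CVal}_\omega}\bigr)=0\qquad(\omega\in\Omega).$$
   Context: $J$ is a finite set with $|J|\ge2$ elements, $\Omega=J^{\mathbb Z}$. The single site potentials are short range: for some $\varepsilon'>0$ and constants $C_\alpha$, $|\partial^\alpha W_j(q)|\le C_\alpha(1+q^2)^{-(1+\varepsilon')/2}$ for $q\in\mathbb R$, $\alpha\in\{0,1,2\}$. For $\omega\in\Omega$ the potential is $V_\omega(q)=\sum_{\ell\in\mathbb Z}W_{\omega(\ell)}(q-\ell)$, and $\mathrm{CVal}_\omega=\{V_\omega(q)\mid q\in\mathbb R,\ V_\omega'(q)=0\}$ is the set of singular (critical) values of $V_\omega$. $\lambda^1$ is Lebesgue measure on $\mathbb R$; the bar denotes closure. *)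

theory Defs
  imports "HOL-Analysis.Analysis" "HOL-Library.Landau_Symbols"
begin

definition C2 :: "(real \<Rightarrow> real) \<Rightarrow> bool" where
  "C2 f \<longleftrightarrow> f C1_differentiable_on UNIV \<and> deriv f C1_differentiable_on UNIV"

definition short_range :: "'j set \<Rightarrow> ('j \<Rightarrow> real \<Rightarrow> real) \<Rightarrow> bool" where
  "short_range J W \<longleftrightarrow>
     (\<exists>\<epsilon>'>0. \<exists>C :: nat \<Rightarrow> real. \<forall>j\<in>J. \<forall>\<alpha>\<in>{0, 1, 2}. \<forall>q.
        \<bar>(deriv ^^ \<alpha>) (W j) q\<bar> \<le> C \<alpha> * (1 + q\<^sup>2) powr (- (1 + \<epsilon>') / 2))"

text \<open>For short-range single site potentials the series converges absolutely, so the
  unordered sum below is the usual sum over the integers.\<close>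

definition potential :: "('j \<Rightarrow> real \<Rightarrow> real) \<Rightarrow> (int \<Rightarrow> 'j) \<Rightarrow> real \<Rightarrow> real" where
  "potential W \<omega> q = (\<Sum>\<^sub>\<infinity>l::int. W (\<omega> l) (q - of_int l))"

definition critical_values :: "(real \<Rightarrow> real) \<Rightarrow> real set" where
  "critical_values V = {V q | q. (V has_real_derivative 0) (at q)}"

end

theory Submission
  imports Defs
begin

text \<open>Two configurations that agree on \<open>[-N, N]\<close> have potentials that differ on the unit interval by
  \<open>O(k powr (-(4 + \<epsilon>/2) N))\<close>, where \<open>k = card J\<close>. Near a critical point a potential varies only
  quadratically, so on a cell of length \<open>1/m\<close> all critical values of all potentials of one of the
  \<open>k ^ (2N + 1)\<close> types lie within \<open>O(1/m\<^sup>2 + k powr (-(4 + \<epsilon>/2) N))\<close> of one another. With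
  \<open>m \<approx> k powr ((2 + \<epsilon>/4) N)\<close> this covers the critical values by finitely many closed intervals (hence
  it covers their closure too) of total length \<open>O(k powr (-\<epsilon> N / 4))\<close>. By translation invariance the
  unit interval suffices, provided all configurations are treated at once.\<close>

section \<open>Unordered sums and their majorants\<close>

lemma infsum_dominated:
  fixes f g :: "'a \<Rightarrow> real"
  assumes g: "g summable_on A" and le: "\<And>x. x \<in> A \<Longrightarrow> \<bar>f x\<bar> \<le> g x"
  shows "f summable_on A" and "\<bar>infsum f A\<bar> \<le> infsum g A"
proof -
  have "(\<lambda>x. norm (g x)) summable_on A"
    using g le by (subst summable_on_cong[of _ _ g]) force+
  then have f: "(\<lambda>x. norm (f x)) summable_on A"
    by (rule Infinite_Sum.abs_summable_on_comparison_test) (use le in force)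
  then show "f summable_on A"
    by (rule abs_summable_summable)
  have "\<bar>infsum f A\<bar> \<le> infsum (\<lambda>x. norm (f x)) A"
    using norm_infsum_bound[OF f] by simp
  also have "\<dots> \<le> infsum g A"
    by (rule infsum_mono[OF f g]) (use le in force)
  finally show "\<bar>infsum f A\<bar> \<le> infsum g A" .
qed

lemma
  fixes f g :: "'a \<Rightarrow> real"
  assumes f: "f summable_on A" and g: "g summable_on A"
  shows summable_on_diff_real: "(\<lambda>x. f x - g x) summable_on A"
    and infsum_diff_real: "infsum (\<lambda>x. f x - g x) A = infsum f A - infsum g A"
proof -
  have g': "(\<lambda>x. - g x) summable_on A"
    using g by (simp add: summable_on_uminus)
  show "(\<lambda>x. f x - g x) summable_on A"
    using summable_on_add[OF f g'] by simp
  show "infsum (\<lambda>x. f x - g x) A = infsum f A - infsum g A"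
    using infsum_add[OF f g'] by (simp add: infsum_uminus)
qed

text \<open>Nonnegativity makes the series over the naturals converge unconditionally. The
  nonnegative integers carry one copy of it, the negative ones a shifted copy.\<close>

lemma summable_on_int_abs:
  fixes g :: "real \<Rightarrow> real"
  assumes g: "summable (\<lambda>n. g (real n))" and nonneg: "\<And>x. 0 \<le> g x"
  shows "(\<lambda>l::int. g \<bar>of_int l\<bar>) summable_on UNIV"
proof -
  have nat: "(\<lambda>n. g (real n)) summable_on UNIV"
    by (rule norm_summable_imp_summable_on) (use g nonneg in simp)
  have "(\<lambda>l::int. g \<bar>of_int l\<bar>) summable_on range int"
    by (subst summable_on_reindex) (use nat in \<open>auto simp: o_def\<close>)
  \<comment> \<open>\<open>Suc\<close> leaves zero to the first half, so the two ranges are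
    disjoint.\<close>
  moreover have "(\<lambda>l::int. g \<bar>of_int l\<bar>) summable_on (range (\<lambda>n. - int (Suc n)))"
  proof (subst summable_on_reindex)
    show "inj (\<lambda>n. - int (Suc n))"
      by (auto simp: inj_on_def)
    have "summable (\<lambda>n. g (real (Suc n)))"
      using g summable_Suc_iff[of "\<lambda>n. g (real n)"] by simp
    then have "(\<lambda>n. g (real (Suc n))) summable_on UNIV"
      by (intro norm_summable_imp_summable_on) (use nonneg in simp)
    then show "((\<lambda>l::int. g \<bar>of_int l\<bar>) \<circ> (\<lambda>n. - int (Suc n))) summable_on UNIV"
      by (simp add: o_def add_ac)
  qed
  moreover have "range int \<inter> range (\<lambda>n. - int (Suc n)) = {}"
    by auto
  moreover have "range int \<union> range (\<lambda>n. - int (Suc n)) = UNIV"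
  proof -
    have "l \<in> range int \<union> range (\<lambda>n. - int (Suc n))" for l
      by (cases l) auto
    then show ?thesis by blast
  qed
  ultimately show ?thesis
    by (metis summable_on_Un_disjoint)
qed

lemma summable_on_int_exp:
  fixes b :: real
  assumes "b > 0"
  shows "(\<lambda>l::int. exp (- b * \<bar>of_int l\<bar>)) summable_on UNIV"
proof (rule summable_on_int_abs[of "\<lambda>x. exp (- b * x)"])
  have "summable (\<lambda>n. exp (- b) ^ n)"
    by (rule summable_geometric) (use assms in simp)
  then show "summable (\<lambda>n. exp (- b * real n))"
    by (simp add: exp_of_nat_mult[symmetric] mult.commute)
qed simp

section \<open>Exponential decay of a function from that of its derivative\<close>

text \<open>Since \<open>c / b * exp (- b * y)\<close> has derivative
  \<open>- c * exp (- b * y)\<close>, adding it to \<open>f\<close> gives a function that is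
  nonincreasing on the half-line and tends to 0, hence is nonnegative there.\<close>

lemma lower_bound_of_exp_derivative:
  fixes f f' :: "real \<Rightarrow> real"
  assumes deriv: "\<And>x. (f has_real_derivative f' x) (at x)"
    and bound: "\<And>x. x \<ge> 0 \<Longrightarrow> f' x \<le> c * exp (- b * x)"
    and b: "b > 0" and lim: "(f \<longlongrightarrow> 0) at_top" and x: "x \<ge> 0"
  shows "- (c / b * exp (- b * x)) \<le> f x"
proof -
  define g where "g = (\<lambda>y. f y + c / b * exp (- b * y))"
  have dg: "(g has_real_derivative f' y - c * exp (- b * y)) (at y)" for y
    unfolding g_def using b by (auto intro!: derivative_eq_intros deriv simp: field_simps)
  have mono: "g y \<le> g x" if "x \<le> y" for y
  proof (rule DERIV_nonpos_imp_nonincreasing[OF that])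
    fix z assume "x \<le> z" "z \<le> y"
    then show "\<exists>d. (g has_real_derivative d) (at z) \<and> d \<le> 0"
      using dg[of z] bound[of z] x by (intro exI[of _ "f' z - c * exp (- b * z)"]) simp
  qed
  have "((\<lambda>y. c / b * exp (- b * y)) \<longlongrightarrow> 0) at_top"
    by (intro tendsto_mult_right_zero
        filterlim_compose[OF exp_at_bot]
        filterlim_tendsto_neg_mult_at_bot[OF tendsto_const _ filterlim_ident]) (use b in simp)
  then have "(g \<longlongrightarrow> 0) at_top"
    unfolding g_def using tendsto_add[OF lim] by fastforce
  then have "0 \<le> g x"
    by (rule tendsto_upperbound)
      (use mono in \<open>auto intro: eventually_mono[OF eventually_ge_at_top[of x]]\<close>)
  then show ?thesis
    by (simp add: g_def)
qed

text \<open>The one-sided bound is applied to the function and its negative, on the right half-line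
  and, after reflection, on the left one. The limit at infinity fixes the constant of
  integration.\<close>

lemma exp_decay_of_derivative:
  fixes f f' :: "real \<Rightarrow> real"
  assumes deriv: "\<And>x. (f has_real_derivative f' x) (at x)"
    and bound: "\<And>x. \<bar>f' x\<bar> \<le> c * exp (- b * \<bar>x\<bar>)"
    and b: "b > 0" and lim: "(f \<longlongrightarrow> 0) at_infinity"
  shows "\<bar>f x\<bar> \<le> c / b * exp (- b * \<bar>x\<bar>)"
proof -
  have half_line: "\<bar>h x\<bar> \<le> c / b * exp (- b * x)"
    if dh: "\<And>x. (h has_real_derivative h' x) (at x)"
      and bh: "\<And>x. \<bar>h' x\<bar> \<le> c * exp (- b * \<bar>x\<bar>)"
      and lh: "(h \<longlongrightarrow> 0) at_top" and x: "x \<ge> 0"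
    for h h' :: "real \<Rightarrow> real" and x
  proof -
    have "- (c / b * exp (- b * x)) \<le> h x"
    proof (rule lower_bound_of_exp_derivative[OF dh _ b lh x])
      fix y :: real assume "y \<ge> 0"
      then show "h' y \<le> c * exp (- b * y)" using bh[of y] by simp
    qed
    moreover have "- (c / b * exp (- b * x)) \<le> - h x"
    proof (rule lower_bound_of_exp_derivative[OF DERIV_minus[OF dh] _ b _ x])
      fix y :: real assume "y \<ge> 0"
      then show "- h' y \<le> c * exp (- b * y)" using bh[of y] by simp
    next
      show "((\<lambda>x. - h x) \<longlongrightarrow> 0) at_top" using tendsto_minus[OF lh] by simp
    qed
    ultimately show ?thesis by linarith
  qed
  have top: "(f \<longlongrightarrow> 0) at_top" and bot: "(f \<longlongrightarrow> 0) at_bot"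
    using lim tendsto_mono at_top_le_at_infinity at_bot_le_at_infinity by blast+
  show ?thesis
  proof (cases "x \<ge> 0")
    case True
    then show ?thesis using half_line[OF deriv bound top True] by simp
  next
    case False
    have "((\<lambda>x. f (- x)) has_real_derivative - f' (- x)) (at x)" for x
      using DERIV_chain2[OF deriv DERIV_minus[OF DERIV_ident]] by simp
    moreover have "\<bar>- f' (- x)\<bar> \<le> c * exp (- b * \<bar>x\<bar>)" for x
      using bound[of "-x"] by simp
    moreover have "((\<lambda>x. f (- x)) \<longlongrightarrow> 0) at_top"
      using bot filterlim_compose filterlim_uminus_at_bot_at_top by blast
    ultimately have "\<bar>f (- (- x))\<bar> \<le> c / b * exp (- b * (- x))"
      using half_line[of "\<lambda>x. f (- x)" "\<lambda>x. - f' (- x)" "- x"] False by simp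
    then show ?thesis using False by simp
  qed
qed

section \<open>Measure of a closure by finite covering\<close>

text \<open>All values from one cell lie within \<open>r\<close> of the value at a chosen
  representative. A finite union of closed intervals is closed, so it covers the closure as
  well.\<close>

lemma emeasure_closure_image_le:
  fixes f :: "'p \<Rightarrow> real" and cell :: "'p \<Rightarrow> 'i"
  assumes fin: "finite I" and cell: "\<And>p. p \<in> P \<Longrightarrow> cell p \<in> I"
    and osc: "\<And>p p'. p \<in> P \<Longrightarrow> p' \<in> P \<Longrightarrow> cell p = cell p' \<Longrightarrow> \<bar>f p - f p'\<bar> \<le> r"
    and r: "r \<ge> 0"
  shows "emeasure lborel (closure (f ` P)) \<le> ennreal (real (card I) * (2 * r))"
proof -
  \<comment> \<open>For an empty cell the choice is arbitrary; its interval is merely counted in the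
    bound.\<close>
  define c where "c i = f (SOME p. p \<in> P \<and> cell p = i)" for i
  define U where "U = (\<Union>i\<in>I. {c i - r..c i + r})"
  have "f p \<in> U" if "p \<in> P" for p
  proof -
    have "(SOME p'. p' \<in> P \<and> cell p' = cell p) \<in> P \<and> cell (SOME p'. p' \<in> P \<and> cell p' = cell p) = cell p"
      by (rule someI[of _ p]) (use that in simp)
    then have "\<bar>f p - c (cell p)\<bar> \<le> r"
      unfolding c_def using osc that by metis
    then show ?thesis
      unfolding U_def using cell[OF that] by (auto intro!: bexI[of _ "cell p"] simp: abs_le_iff)
  qed
  then have "closure (f ` P) \<subseteq> U"
    by (intro closure_minimal) (auto simp: U_def fin)
  then have "emeasure lborel (closure (f ` P)) \<le> emeasure lborel U"
    by (rule emeasure_mono) (auto simp: U_def fin)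
  also have "\<dots> \<le> (\<Sum>i\<in>I. emeasure lborel {c i - r..c i + r})"
    unfolding U_def by (rule emeasure_subadditive_finite) (auto simp: fin)
  also have "\<dots> = (\<Sum>i\<in>I. ennreal (2 * r))"
    using r by (intro sum.cong) auto
  also have "\<dots> = ennreal (real (card I) * (2 * r))"
    using r by (simp add: ennreal_mult ennreal_of_nat_eq_real_of_nat)
  finally show ?thesis .
qed

section \<open>Polynomial majorant and Taylor estimate\<close>

text \<open>The base is a lower bound of \<open>1 + (q - l)^2\<close> valid for all \<open>q\<close>
  in [-1, 2] at once. Up to a constant factor the terms are those of the series of
  \<open>n powr (- (1 + e))\<close>.\<close>

lemma summable_on_int_powr:
  fixes e :: real
  assumes "e > 0"
  shows "(\<lambda>l::int. (((\<bar>of_int l\<bar> + 1)\<^sup>2 / 18) powr (- (1 + e) / 2))) summable_on UNIV"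
proof (rule summable_on_int_abs[of "\<lambda>x. ((x + 1)\<^sup>2 / 18) powr (- (1 + e) / 2)"])
  have "summable (\<lambda>n. real (Suc n) powr (- (1 + e)))"
    using summable_Suc_iff[of "\<lambda>n. real n powr (- (1 + e))"] assms
    by (simp add: summable_real_powr_iff)
  then have "summable (\<lambda>n. (1 / 18) powr (- (1 + e) / 2) * real (Suc n) powr (- (1 + e)))"
    by (rule summable_mult)
  moreover have "(1 / 18) powr (- (1 + e) / 2) * real (Suc n) powr (- (1 + e))
      = ((real n + 1)\<^sup>2 / 18) powr (- (1 + e) / 2)" for n
  proof -
    have "((real n + 1)\<^sup>2 / 18) powr (- (1 + e) / 2)
        = (1 / 18 * (real (Suc n) powr 2)) powr (- (1 + e) / 2)"
      by (simp add: powr_numeral add_ac)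
    also have "\<dots> = (1 / 18) powr (- (1 + e) / 2) * (real (Suc n) powr 2) powr (- (1 + e) / 2)"
      by (rule powr_mult)
    also have "(real (Suc n) powr 2) powr (- (1 + e) / 2) = real (Suc n) powr (- (1 + e))"
    proof -
      have "2 * (- (1 + e) / 2) = - (1 + e)" by simp
      then show ?thesis by (simp only: powr_powr)
    qed
    finally show ?thesis ..
  qed
  ultimately show "summable (\<lambda>n. ((real n + 1)\<^sup>2 / 18) powr (- (1 + e) / 2))"
    by (simp only:)
qed auto

text \<open>The mean value theorem is used twice: for \<open>f\<close>, and for \<open>f1\<close>
  between \<open>x\<close> and the intermediate point. This gives \<open>M\<close> instead of the
  sharp \<open>M / 2\<close>, which is enough.\<close>

lemma second_order_Taylor_bound:
  fixes f f1 f2 :: "real \<Rightarrow> real"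
  assumes f: "\<And>x. (f has_real_derivative f1 x) (at x)"
    and f1: "\<And>x. (f1 has_real_derivative f2 x) (at x)"
    and bound: "\<And>z. z \<in> closed_segment x y \<Longrightarrow> \<bar>f2 z\<bar> \<le> M"
  shows "\<bar>f y - f x - (y - x) * f1 x\<bar> \<le> M * (y - x)\<^sup>2"
proof -
  have mvt: "\<exists>z\<in>closed_segment u v. g v - g u = (v - u) * g' z"
    if "\<And>x. (g has_real_derivative g' x) (at x)" for g g' :: "real \<Rightarrow> real" and u v
  proof (cases u v rule: linorder_cases)
    case less
    from MVT2[OF less, of g g'] that show ?thesis
      by (metis closed_segment_eq_real_ivl1 atLeastAtMost_iff less less_imp_le)
  next
    case equal
    then show ?thesis by auto
  next
    case greater
    from MVT2[OF greater, of g g'] that obtain z where z: "v < z" "z < u" "g u - g v = (u - v) * g' z"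
      by blast
    then show ?thesis
      by (intro bexI[of _ z]) (auto simp: closed_segment_eq_real_ivl algebra_simps)
  qed
  obtain z where z: "z \<in> closed_segment x y" "f y - f x = (y - x) * f1 z"
    using mvt[OF f] by blast
  obtain w where w: "w \<in> closed_segment x z" "f1 z - f1 x = (z - x) * f2 w"
    using mvt[OF f1] by blast
  have "w \<in> closed_segment x y"
    using z(1) w(1) by (auto simp: closed_segment_eq_real_ivl split: if_splits)
  then have "\<bar>f2 w\<bar> \<le> M" by (rule bound)
  moreover have "\<bar>z - x\<bar> \<le> \<bar>y - x\<bar>"
    using z(1) by (auto simp: closed_segment_eq_real_ivl split: if_splits)
  moreover have "f y - f x - (y - x) * f1 x = (y - x) * ((z - x) * f2 w)"
    unfolding z(2) w(2)[symmetric] by (simp add: algebra_simps)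
  ultimately have "\<bar>f y - f x - (y - x) * f1 x\<bar> \<le> \<bar>y - x\<bar> * (\<bar>y - x\<bar> * M)"
    by (auto simp: abs_mult intro!: mult_mono)
  then show ?thesis
    by (simp add: power2_eq_square mult_ac flip: abs_mult)
qed

section \<open>Potentials with exponentially decaying single sites\<close>

text \<open>The exponential bound on \<open>W\<close> controls the effect of distant sites; the
  polynomial bound on \<open>W2\<close>, supplied by the short range condition, controls the
  quadratic variation near a critical point.\<close>

locale exp_decaying =
  fixes J :: "'j set" and W W1 W2 :: "'j \<Rightarrow> real \<Rightarrow> real" and b c B e :: real
  assumes deriv_W: "\<And>j x. j \<in> J \<Longrightarrow> (W j has_real_derivative W1 j x) (at x)"
    and deriv_W1: "\<And>j x. j \<in> J \<Longrightarrow> (W1 j has_real_derivative W2 j x) (at x)"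
    and W_le: "\<And>j x. j \<in> J \<Longrightarrow> \<bar>W j x\<bar> \<le> c * exp (- b * \<bar>x\<bar>)"
    and W1_le: "\<And>j x. j \<in> J \<Longrightarrow> \<bar>W1 j x\<bar> \<le> c * exp (- b * \<bar>x\<bar>)"
    and W2_le: "\<And>j x. j \<in> J \<Longrightarrow> \<bar>W2 j x\<bar> \<le> B * (1 + x\<^sup>2) powr (- (1 + e) / 2)"
    and pos: "b > 0" "e > 0" "c \<ge> 0" "B \<ge> 0"
begin

text \<open>The interval [-1, 2] contains all points within distance 1 of [0, 1], which leaves room
  for difference quotients. On it |l| \<le> 2 + |q - l|, whence the factor
  \<open>exp (2 * b)\<close>.\<close>

definition envelope :: "int \<Rightarrow> real" where
  "envelope l = c * exp (2 * b) * exp (- b * \<bar>of_int l\<bar>)"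

lemma envelope_summable: "envelope summable_on UNIV"
  unfolding envelope_def by (intro summable_on_cmult_right summable_on_int_exp pos)

lemma exp_le_envelope:
  assumes "q \<in> {-1..2}"
  shows "c * exp (- b * \<bar>q - of_int l\<bar>) \<le> envelope l"
proof -
  have "b * \<bar>of_int l\<bar> \<le> b * (2 + \<bar>q - of_int l\<bar>)"
    using assms pos by (intro mult_left_mono) auto
  then have "exp (- b * \<bar>q - of_int l\<bar>) \<le> exp (2 * b + - b * \<bar>of_int l\<bar>)"
    by (simp add: algebra_simps)
  then show ?thesis
    unfolding envelope_def using pos(3) by (simp only: exp_add mult.assoc mult_left_mono)
qed

lemma W_le_envelope: "j \<in> J \<Longrightarrow> q \<in> {-1..2} \<Longrightarrow> \<bar>W j (q - of_int l)\<bar> \<le> envelope l"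
  and W1_le_envelope: "j \<in> J \<Longrightarrow> q \<in> {-1..2} \<Longrightarrow> \<bar>W1 j (q - of_int l)\<bar> \<le> envelope l"
  using W_le W1_le exp_le_envelope order_trans by blast+

definition envelope2 :: "int \<Rightarrow> real" where
  "envelope2 l = B * (((\<bar>of_int l\<bar> + 1)\<^sup>2 / 18) powr (- (1 + e) / 2))"

lemma envelope2_summable: "envelope2 summable_on UNIV"
  unfolding envelope2_def by (intro summable_on_cmult_right summable_on_int_powr pos)

lemma W2_le_envelope2:
  assumes j: "j \<in> J" and q: "q \<in> {-1..2}"
  shows "\<bar>W2 j (q - of_int l)\<bar> \<le> envelope2 l"
proof -
  define t where "t = \<bar>q - of_int l\<bar>"
  have "\<bar>of_int l\<bar> + 1 \<le> t + 3"
    using q unfolding t_def by auto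
  then have "(\<bar>of_int l\<bar> + 1)\<^sup>2 \<le> (t + 3)\<^sup>2"
    by (intro power_mono) auto
  \<comment> \<open>The added squares cancel the cross term and complete the sum to a multiple of
    \<open>1 + t^2\<close>; this is the origin of the 18.\<close>
  also have "\<dots> \<le> (t + 3)\<^sup>2 + (t - 3)\<^sup>2 + 16 * t\<^sup>2"
    by simp
  also have "\<dots> = 18 * (1 + t\<^sup>2)"
    by (simp add: power2_sum power2_diff)
  finally have "(\<bar>of_int l\<bar> + 1)\<^sup>2 / 18 \<le> 1 + (q - of_int l)\<^sup>2"
    by (simp add: t_def)
  then have "(1 + (q - of_int l)\<^sup>2) powr (- (1 + e) / 2)
      \<le> ((\<bar>of_int l\<bar> + 1)\<^sup>2 / 18) powr (- (1 + e) / 2)"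
    by (intro powr_mono2') (use pos in \<open>auto intro!: divide_pos_pos zero_less_power\<close>)
  then show ?thesis
    unfolding envelope2_def
    by (intro order_trans[OF W2_le[OF j]] mult_left_mono) (use pos in auto)
qed

text \<open>The constant does not depend on the configuration, so one cell may mix critical points
  of different potentials.\<close>

definition curvature :: real where
  "curvature = (\<Sum>\<^sub>\<infinity>l. envelope2 l)"

lemma curvature_nonneg: "curvature \<ge> 0"
  unfolding curvature_def envelope2_def using pos by (intro infsum_nonneg) auto

context
  fixes \<omega> :: "int \<Rightarrow> 'j"
  assumes \<omega>: "\<omega> \<in> UNIV \<rightarrow> J"
begin

lemma potential_summable: "q \<in> {-1..2} \<Longrightarrow> (\<lambda>l. W (\<omega> l) (q - of_int l)) summable_on UNIV"
  by (rule infsum_dominated(1)[OF envelope_summable]) (use W_le_envelope \<omega> in blast)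

text \<open>The Taylor bounds of the single terms are summed against \<open>envelope2\<close>; no
  theorem on differentiating a series is invoked.\<close>

lemma potential_Taylor_bound:
  assumes p: "p \<in> {-1..2}" and q: "q \<in> {0..1}"
  shows "\<bar>potential W \<omega> p - potential W \<omega> q - (p - q) * (\<Sum>\<^sub>\<infinity>l. W1 (\<omega> l) (q - of_int l))\<bar>
      \<le> curvature * (p - q)\<^sup>2"
proof -
  have q': "q \<in> {-1..2}" using q by auto
  have s1: "(\<lambda>l. W1 (\<omega> l) (q - of_int l)) summable_on UNIV"
    by (rule infsum_dominated(1)[OF envelope_summable]) (use W1_le_envelope \<omega> q' in blast)
  let ?r = "\<lambda>l. W (\<omega> l) (p - of_int l) - W (\<omega> l) (q - of_int l) - (p - q) * W1 (\<omega> l) (q - of_int l)"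
  have r: "\<bar>?r l\<bar> \<le> envelope2 l * (p - q)\<^sup>2" for l
  proof -
    have j: "\<omega> l \<in> J" using \<omega> by auto
    \<comment> \<open>Shifted back by \<open>l\<close>, the segment joins \<open>q\<close> to
      \<open>p\<close> and stays in [-1, 2], where \<open>envelope2\<close> applies.\<close>
    have "\<bar>W2 (\<omega> l) z\<bar> \<le> envelope2 l" if "z \<in> closed_segment (q - of_int l) (p - of_int l)" for z
      using W2_le_envelope2[OF j, of "z + of_int l" l] that p q
      by (auto simp: closed_segment_eq_real_ivl split: if_splits)
    then have "\<bar>W (\<omega> l) (p - of_int l) - W (\<omega> l) (q - of_int l)
        - (p - of_int l - (q - of_int l)) * W1 (\<omega> l) (q - of_int l)\<bar>
      \<le> envelope2 l * (p - of_int l - (q - of_int l))\<^sup>2"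
      by (rule second_order_Taylor_bound[OF deriv_W[OF j] deriv_W1[OF j]])
    then show ?thesis by simp
  qed
  have "\<bar>\<Sum>\<^sub>\<infinity>l. ?r l\<bar> \<le> (\<Sum>\<^sub>\<infinity>l. envelope2 l * (p - q)\<^sup>2)"
    by (rule infsum_dominated(2)[OF summable_on_cmult_left[OF envelope2_summable] r])
  also have "(\<Sum>\<^sub>\<infinity>l. envelope2 l * (p - q)\<^sup>2) = curvature * (p - q)\<^sup>2"
    unfolding curvature_def by (rule infsum_cmult_left')
  also have "(\<Sum>\<^sub>\<infinity>l. ?r l) = potential W \<omega> p - potential W \<omega> q
      - (p - q) * (\<Sum>\<^sub>\<infinity>l. W1 (\<omega> l) (q - of_int l))"
    unfolding potential_def using potential_summable p q' s1
    by (simp add: infsum_diff_real summable_on_diff_real summable_on_cmult_right infsum_cmult_right')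
  finally show ?thesis .
qed

text \<open>The term-by-term derivative need not be identified separately: by the Taylor bound it is the
  only possible value of the derivative, so it vanishes at a critical point.\<close>

lemma potential_near_critical_point:
  assumes p: "p \<in> {-1..2}" and q: "q \<in> {0..1}"
    and crit: "(potential W \<omega> has_real_derivative 0) (at q)"
  shows "\<bar>potential W \<omega> p - potential W \<omega> q\<bar> \<le> curvature * (p - q)\<^sup>2"
proof -
  define D where "D = (\<Sum>\<^sub>\<infinity>l. W1 (\<omega> l) (q - of_int l))"
  let ?quot = "\<lambda>x. (potential W \<omega> x - potential W \<omega> q) / (x - q)"
  have bound: "\<forall>\<^sub>F x in at q. norm (?quot x - D) \<le> curvature * \<bar>x - q\<bar>"
    unfolding eventually_at
  proof (intro exI[of _ 1] conjI ballI impI)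
    fix x :: real assume x: "x \<noteq> q \<and> dist x q < 1"
    then have "x \<in> {-1..2}" using q by (auto simp: dist_real_def)
    from potential_Taylor_bound[OF this q]
    have "\<bar>potential W \<omega> x - potential W \<omega> q - (x - q) * D\<bar> / \<bar>x - q\<bar>
        \<le> curvature * (x - q)\<^sup>2 / \<bar>x - q\<bar>"
      unfolding D_def by (rule divide_right_mono) simp
    also have "curvature * (x - q)\<^sup>2 / \<bar>x - q\<bar> = curvature * \<bar>x - q\<bar>"
      using x by (simp add: power2_eq_square field_simps flip: abs_mult)
    also have "\<bar>potential W \<omega> x - potential W \<omega> q - (x - q) * D\<bar> / \<bar>x - q\<bar> = \<bar>?quot x - D\<bar>"
      using x by (simp add: diff_divide_distrib flip: abs_divide)
    finally show "norm (?quot x - D) \<le> curvature * \<bar>x - q\<bar>"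
      by (simp only: real_norm_def)
  qed simp
  have "((\<lambda>x. curvature * \<bar>x - q\<bar>) \<longlongrightarrow> 0) (at q)"
    by (auto intro!: tendsto_eq_intros)
  from Lim_null_comparison[OF bound this] have "(?quot \<longlongrightarrow> D) (at q)"
    by (rule LIM_zero_cancel)
  moreover have "(?quot \<longlongrightarrow> 0) (at q)"
    using crit by (simp only: has_field_derivative_iff)
  ultimately have "D = 0"
    by (intro tendsto_unique[OF trivial_limit_at])
  then show ?thesis
    using potential_Taylor_bound[OF p q] by (simp add: D_def)
qed

end

text \<open>What remains of twice the envelope, one for each of two configurations, after the part
  \<open>b - \<theta>\<close> of the rate has been spent on a factor depending on the window.
  Summing over all integers keeps it independent of the window.\<close>

definition tail :: "real \<Rightarrow> real" where
  "tail \<theta> = (\<Sum>\<^sub>\<infinity>l::int. 2 * c * exp (2 * b) * exp (- \<theta> * \<bar>of_int l\<bar>))"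

lemma tail_nonneg: "tail \<theta> \<ge> 0"
  unfolding tail_def using pos by (intro infsum_nonneg) auto

text \<open>Sites inside the window cancel. Outside it |l| \<ge> N, so
  \<open>exp (- b * |l|)\<close> splits into the small factor
  \<open>exp (- (b - \<theta>) * N)\<close> and the summable
  \<open>exp (- \<theta> * |l|)\<close>.\<close>

lemma potential_diff_le_tail:
  fixes N :: nat
  assumes \<omega>: "\<omega> \<in> UNIV \<rightarrow> J" and \<sigma>: "\<sigma> \<in> UNIV \<rightarrow> J"
    and agree: "\<And>l. l \<in> {- int N..int N} \<Longrightarrow> \<omega> l = \<sigma> l"
    and q: "q \<in> {-1..2}" and \<theta>: "0 < \<theta>" "\<theta> \<le> b"
  shows "\<bar>potential W \<omega> q - potential W \<sigma> q\<bar> \<le> exp (- (b - \<theta>) * N) * tail \<theta>"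
proof -
  let ?g = "\<lambda>l::int. exp (- (b - \<theta>) * N) * (2 * c * exp (2 * b) * exp (- \<theta> * \<bar>of_int l\<bar>))"
  have g: "?g summable_on UNIV"
    by (intro summable_on_cmult_right summable_on_int_exp \<theta>)
  have le: "\<bar>W (\<omega> l) (q - of_int l) - W (\<sigma> l) (q - of_int l)\<bar> \<le> ?g l" for l
  proof (cases "l \<in> {- int N..int N}")
    case True
    then show ?thesis using agree[OF True] pos by simp
  next
    case False
    then have "real N \<le> \<bar>of_int l\<bar>" by auto
    then have "(b - \<theta>) * real N \<le> (b - \<theta>) * \<bar>of_int l\<bar>"
      using \<theta> by (intro mult_left_mono) auto
    then have "exp (- b * \<bar>of_int l\<bar>) \<le> exp (- (b - \<theta>) * N + - \<theta> * \<bar>of_int l\<bar>)"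
      by (simp add: algebra_simps)
    then have "2 * c * exp (2 * b) * exp (- b * \<bar>of_int l\<bar>)
        \<le> 2 * c * exp (2 * b) * exp (- (b - \<theta>) * N + - \<theta> * \<bar>of_int l\<bar>)"
      using pos by (intro mult_left_mono) auto
    also have "\<dots> = ?g l"
      by (simp only: exp_add mult_ac)
    finally have "2 * envelope l \<le> ?g l"
      unfolding envelope_def by (simp only: mult.assoc)
    moreover have "\<omega> l \<in> J" "\<sigma> l \<in> J" using \<omega> \<sigma> by auto
    ultimately show ?thesis
      using W_le_envelope[of "\<omega> l" q l] W_le_envelope[of "\<sigma> l" q l] q by linarith
  qed
  have "potential W \<omega> q - potential W \<sigma> q
      = (\<Sum>\<^sub>\<infinity>l. W (\<omega> l) (q - of_int l) - W (\<sigma> l) (q - of_int l))"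
    unfolding potential_def using potential_summable[OF \<omega> q] potential_summable[OF \<sigma> q]
    by (simp add: infsum_diff_real)
  also have "\<bar>\<dots>\<bar> \<le> (\<Sum>\<^sub>\<infinity>l. ?g l)"
    by (rule infsum_dominated(2)[OF g le])
  also have "\<dots> = exp (- (b - \<theta>) * N) * tail \<theta>"
    unfolding tail_def by (rule infsum_cmult_right')
  finally show ?thesis .
qed

end

section \<open>Integer translations\<close>

lemma potential_shift:
  "potential W \<omega> q = potential W (\<lambda>l. \<omega> (l + n)) (q - of_int n)"
proof -
  have "bij_betw (\<lambda>l. l + n) UNIV UNIV"
    by (rule bij_betwI[of _ _ _ "\<lambda>l. l - n"]) auto
  from infsum_reindex_bij_betw[OF this, of "\<lambda>l. W (\<omega> l) (q - of_int l)"]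
  show ?thesis
    unfolding potential_def by (simp add: algebra_simps)
qed

lemma critical_point_shift:
  assumes "(potential W \<omega> has_real_derivative 0) (at q)"
  shows "(potential W (\<lambda>l. \<omega> (l + n)) has_real_derivative 0) (at (q - of_int n))"
proof -
  have "potential W (\<lambda>l. \<omega> (l + n)) = (\<lambda>x. potential W \<omega> (x + of_int n))"
    using potential_shift[of W \<omega> _ n] by auto
  then show ?thesis
    using assms DERIV_shift[of "potential W \<omega>" 0 "q - of_int n" "of_int n"] by simp
qed

section \<open>Covering the critical values\<close>

context exp_decaying
begin

text \<open>Moving a critical point into the unit interval shifts the configuration, so the set
  ranges over all configurations. The interval is half-open so that the floor of
  \<open>m * q\<close> stays below \<open>m\<close>.\<close>

definition unit_critical_points :: "((int \<Rightarrow> 'j) \<times> real) set" where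
  "unit_critical_points = {(\<sigma>, q). \<sigma> \<in> UNIV \<rightarrow> J \<and> q \<in> {0..<1}
      \<and> (potential W \<sigma> has_real_derivative 0) (at q)}"

text \<open>Translation by the floor of the critical point brings it into [0, 1) and preserves its
  critical value.\<close>

lemma critical_values_subset:
  assumes \<omega>: "\<omega> \<in> UNIV \<rightarrow> J"
  shows "critical_values (potential W \<omega>) \<subseteq> (\<lambda>(\<sigma>, q). potential W \<sigma> q) ` unit_critical_points"
proof
  fix v assume "v \<in> critical_values (potential W \<omega>)"
  then obtain q where q: "v = potential W \<omega> q" "(potential W \<omega> has_real_derivative 0) (at q)"
    unfolding critical_values_def by blast
  have "v = potential W (\<lambda>l. \<omega> (l + \<lfloor>q\<rfloor>)) (q - of_int \<lfloor>q\<rfloor>)"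
    unfolding q(1) by (rule potential_shift)
  moreover have "((\<lambda>l. \<omega> (l + \<lfloor>q\<rfloor>)), q - of_int \<lfloor>q\<rfloor>) \<in> unit_critical_points"
    using \<omega> critical_point_shift[OF q(2), of "\<lfloor>q\<rfloor>"]
    by (auto simp: unit_critical_points_def) linarith
  ultimately show "v \<in> (\<lambda>(\<sigma>, q). potential W \<sigma> q) ` unit_critical_points"
    by (auto intro!: rev_image_eqI)
qed

text \<open>A cell consists of a pattern on the window [-N, N] and a subinterval of length
  \<open>1 / m\<close>. The two summands of the radius are the cost of moving the point and of
  changing the configuration outside the window.\<close>

lemma emeasure_critical_values_le:
  fixes N m :: nat
  assumes \<omega>: "\<omega> \<in> UNIV \<rightarrow> J" and J: "finite J" and m: "m > 0" and \<theta>: "0 < \<theta>" "\<theta> \<le> b"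
  shows "emeasure lborel (closure (critical_values (potential W \<omega>)))
    \<le> ennreal (real (card J ^ (2 * N + 1) * m) *
        (2 * (curvature / (real m)\<^sup>2 + exp (- (b - \<theta>) * N) * tail \<theta>)))"
proof -
  let ?V = "\<lambda>(\<sigma>, q). potential W \<sigma> q"
  \<comment> \<open>\<open>restrict\<close> discards the values outside the window, so only finitely
    many patterns remain.\<close>
  let ?cell = "\<lambda>(\<sigma>, q). (restrict \<sigma> {- int N..int N}, nat \<lfloor>real m * q\<rfloor>)"
  let ?I = "({- int N..int N} \<rightarrow>\<^sub>E J) \<times> {..<m}"
  let ?r = "curvature / (real m)\<^sup>2 + exp (- (b - \<theta>) * N) * tail \<theta>"
  have cell: "?cell x \<in> ?I" if x: "x \<in> unit_critical_points" for x
  proof -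
    obtain \<sigma> q where [simp]: "x = (\<sigma>, q)" by (cases x)
    have \<sigma>: "\<sigma> \<in> UNIV \<rightarrow> J" and q: "0 \<le> q" "q < 1"
      using x by (auto simp: unit_critical_points_def)
    have "real m * q < real m" using q m by simp
    then have "nat \<lfloor>real m * q\<rfloor> < m"
      using q by (simp add: nat_less_iff floor_less_iff)
    then show ?thesis using \<sigma> by (auto intro!: restrict_PiE_iff[THEN iffD2])
  qed
  have osc: "\<bar>?V x - ?V y\<bar> \<le> ?r"
    if x: "x \<in> unit_critical_points" and y: "y \<in> unit_critical_points" and xy: "?cell x = ?cell y"
    for x y
  proof -
    obtain \<sigma> p where x': "x = (\<sigma>, p)" by (cases x)
    obtain \<tau> q where y': "y = (\<tau>, q)" by (cases y)
    have \<sigma>: "\<sigma> \<in> UNIV \<rightarrow> J" and p: "0 \<le> p" "p < 1"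
      using x by (auto simp: unit_critical_points_def x')
    have \<tau>: "\<tau> \<in> UNIV \<rightarrow> J" and q: "0 \<le> q" "q < 1"
      and crit: "(potential W \<tau> has_real_derivative 0) (at q)"
      using y by (auto simp: unit_critical_points_def y')
    have "\<sigma> l = \<tau> l" if "l \<in> {- int N..int N}" for l
      using xy that unfolding x' y' by (auto dest: fun_cong[of _ _ l])
    \<comment> \<open>The comparison passes through \<open>potential W \<tau> p\<close>: first the
      configuration changes at \<open>p\<close>, then \<open>p\<close> moves to the critical point
      \<open>q\<close> of the second potential.\<close>
    from potential_diff_le_tail[OF \<sigma> \<tau> this _ \<theta>, where q = p]
    have "\<bar>potential W \<sigma> p - potential W \<tau> p\<bar> \<le> exp (- (b - \<theta>) * N) * tail \<theta>"
      using p by simp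
    moreover have "\<bar>potential W \<tau> p - potential W \<tau> q\<bar> \<le> curvature / (real m)\<^sup>2"
    proof -
      have "nat \<lfloor>real m * p\<rfloor> = nat \<lfloor>real m * q\<rfloor>"
        using xy by (simp add: x' y')
      then have "\<lfloor>real m * p\<rfloor> = \<lfloor>real m * q\<rfloor>"
        using p q by (simp add: eq_nat_nat_iff)
      then have "\<bar>real m * p - real m * q\<bar> \<le> 1"
        by linarith
      then have "real m * \<bar>p - q\<bar> \<le> 1"
        by (simp add: abs_mult flip: right_diff_distrib)
      then have "\<bar>p - q\<bar> \<le> 1 / real m"
        using m by (simp add: field_simps)
      then have "\<bar>p - q\<bar>\<^sup>2 \<le> (1 / real m)\<^sup>2"
        by (rule power_mono) simp
      then have "curvature * (p - q)\<^sup>2 \<le> curvature * (1 / real m)\<^sup>2"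
        using curvature_nonneg by (intro mult_left_mono) auto
      then show ?thesis
        using potential_near_critical_point[OF \<tau> _ _ crit, of p] p q by (simp add: power_divide)
    qed
    ultimately show ?thesis
      unfolding x' y' by simp
  qed
  have "emeasure lborel (closure (critical_values (potential W \<omega>)))
      \<le> emeasure lborel (closure (?V ` unit_critical_points))"
    by (intro emeasure_mono closure_mono critical_values_subset \<omega>) auto
  also have "\<dots> \<le> ennreal (real (card ?I) * (2 * ?r))"
  proof (rule emeasure_closure_image_le[OF _ cell osc])
    show "finite ?I" using J by (intro finite_cartesian_product finite_PiE) auto
    show "0 \<le> ?r" using curvature_nonneg tail_nonneg by simp
  qed
  also have "card ?I = card J ^ (2 * N + 1) * m"
  proof -
    have "card {- int N..int N} = 2 * N + 1" by simp
    then show ?thesis by (simp only: card_cartesian_product card_PiE[OF finite_atLeastAtMost_int]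
          prod_constant card_lessThan)
  qed
  finally show ?thesis .
qed

text \<open>With \<open>m\<close> of order \<open>R\<close>, both errors are of order
  \<open>1 / R^2\<close>, and there are about \<open>K ^ (2 * N + 1) * R\<close> cells. The total
  length is of order \<open>K ^ (2 * N) / R\<close>, so \<open>R\<close> must outgrow
  \<open>K ^ (2 * N)\<close>; an error \<open>1 / R^2\<close> then requires a rate above
  \<open>4 * ln K\<close>.\<close>

lemma emeasure_critical_values_eq_0:
  assumes \<omega>: "\<omega> \<in> UNIV \<rightarrow> J" and J: "finite J" "card J \<ge> 2"
    and b: "b > 4 * ln (card J)"
  shows "emeasure lborel (closure (critical_values (potential W \<omega>))) = 0"
proof -
  define K where "K = real (card J)"
  have K: "K > 1" "ln K > 0" using J by (simp_all add: K_def)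
  \<comment> \<open>Half of the excess rate makes the tail summable; the other half,
    \<open>2 * \<delta>\<close>, yields the decay in \<open>N\<close>.\<close>
  define \<theta> where "\<theta> = (b - 4 * ln K) / 2"
  define Y where "Y = curvature + tail \<theta>"
  define \<delta> where "\<delta> = \<theta> / 2"
  have b_K: "4 * ln K < b" using b by (simp add: K_def)
  have \<theta>: "0 < \<theta>" "\<theta> \<le> b" and \<delta>: "\<delta> > 0"
    using b_K K(2) unfolding \<theta>_def \<delta>_def by (simp_all add: field_simps)
  have b': "b - \<theta> = 4 * ln K + 2 * \<delta>"
    unfolding \<theta>_def \<delta>_def by (simp add: field_simps)
  let ?\<mu> = "emeasure lborel (closure (critical_values (potential W \<omega>)))"
  have le: "?\<mu> \<le> ennreal (4 * K * Y * exp (- \<delta>) ^ N)" for N :: nat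
  proof -
    \<comment> \<open>Chosen so that \<open>R^2 = exp ((b - \<theta>) * N)\<close>, which balances
      the truncation error against the error \<open>1 / m^2\<close> of the subdivision.\<close>
    define R where "R = exp ((2 * ln K + \<delta>) * N)"
    define m where "m = nat \<lceil>R\<rceil>"
    \<comment> \<open>This ensures that rounding up at most doubles \<open>R\<close>.\<close>
    have "R \<ge> 1" using K \<delta> by (simp add: R_def)
    then have m: "R \<le> real m" "real m \<le> 2 * R" "m > 0"
      unfolding m_def by linarith+
    have R2: "exp (- (b - \<theta>) * N) = 1 / R\<^sup>2"
      unfolding R_def b' by (simp add: exp_minus[symmetric] inverse_eq_divide[symmetric]
          exp_double[symmetric] algebra_simps)
    have "curvature / (real m)\<^sup>2 \<le> curvature / R\<^sup>2"
      using \<open>R \<ge> 1\<close> m curvature_nonneg by (intro divide_left_mono power_mono) auto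
    then have r: "curvature / (real m)\<^sup>2 + exp (- (b - \<theta>) * N) * tail \<theta> \<le> Y / R\<^sup>2"
      unfolding R2 Y_def by (simp add: add_divide_distrib)
    have R: "K ^ (2 * N) / R = exp (- \<delta>) ^ N"
    proof -
      have "K ^ (2 * N) = exp (ln K * (2 * N))"
        using K by (metis exp_ln exp_of_nat2_mult less_trans zero_less_one of_nat_mult)
      then show ?thesis
        unfolding R_def by (simp add: exp_diff[symmetric] exp_of_nat2_mult[symmetric] algebra_simps)
    qed
    have "real (card J ^ (2 * N + 1) * m) *
        (2 * (curvature / (real m)\<^sup>2 + exp (- (b - \<theta>) * N) * tail \<theta>))
      \<le> (K ^ (2 * N + 1) * (2 * R)) * (2 * (Y / R\<^sup>2))"
      using K m r \<open>R \<ge> 1\<close> curvature_nonneg tail_nonneg[of \<theta>]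
      by (intro mult_mono) (auto simp: K_def[symmetric])
    also have "\<dots> = 4 * K * Y * (K ^ (2 * N) / R)"
      using \<open>R \<ge> 1\<close> by (simp add: power2_eq_square field_simps)
    finally show ?thesis
      unfolding R using emeasure_critical_values_le[OF \<omega> J(1) m(3) \<theta>, of N] ennreal_leI order_trans
      by blast
  qed
  have "(\<lambda>N. exp (- \<delta>) ^ N) \<longlonglongrightarrow> 0"
    by (rule LIMSEQ_power_zero) (use \<delta> in simp)
  then have "(\<lambda>N. ennreal (4 * K * Y * exp (- \<delta>) ^ N)) \<longlonglongrightarrow> ennreal (4 * K * Y * 0)"
    by (intro tendsto_ennrealI tendsto_mult_left)
  \<comment> \<open>The measure does not depend on \<open>N\<close>, so the bounds pass to the
    limit.\<close>
  then have "?\<mu> \<le> 0"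
    by (intro LIMSEQ_le_const[of "\<lambda>N. ennreal (4 * K * Y * exp (- \<delta>) ^ N)"]) (use le in auto)
  then show ?thesis by simp
qed

end

section \<open>From asymptotic to uniform bounds\<close>

text \<open>Far out the asymptotic bound applies; on the remaining compact interval the positive
  continuous \<open>g\<close> has a positive minimum, against which the bound \<open>C\<close> is
  compared.\<close>

lemma bigo_at_infinity_bounded:
  fixes f g :: "real \<Rightarrow> real"
  assumes O: "f \<in> O[at_infinity](g)" and f: "\<And>x. \<bar>f x\<bar> \<le> C"
    and g: "continuous_on UNIV g" "\<And>x. g x > 0"
  obtains c where "\<And>x. \<bar>f x\<bar> \<le> c * g x"
proof -
  obtain c where c: "\<forall>\<^sub>F x in at_infinity. norm (f x) \<le> c * norm (g x)"
    using O by (rule landau_o.bigE)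
  then obtain r where r: "\<And>x. \<bar>x\<bar> \<ge> r \<Longrightarrow> \<bar>f x\<bar> \<le> c * g x"
    using g(2) by (auto simp: eventually_at_infinity less_imp_le)
  \<comment> \<open>The radius \<open>r\<close> may be negative; its absolute value keeps the
    interval nonempty.\<close>
  obtain x0 where "\<forall>x\<in>{- \<bar>r\<bar>..\<bar>r\<bar>}. g x0 \<le> g x"
    using continuous_attains_inf[of "{- \<bar>r\<bar>..\<bar>r\<bar>}" g] continuous_on_subset[OF g(1)] by auto
  then have x0: "g x0 \<le> g x" if "\<bar>x\<bar> \<le> \<bar>r\<bar>" for x
    using that by (auto simp: abs_le_iff)
  show thesis
  proof (rule that[of "max c (C / g x0)"])
    fix x
    show "\<bar>f x\<bar> \<le> max c (C / g x0) * g x"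
    proof (cases "\<bar>x\<bar> \<ge> r")
      case True
      have "c * g x \<le> max c (C / g x0) * g x"
        using g(2)[of x] by (intro mult_right_mono) auto
      then show ?thesis using r[OF True] by linarith
    next
      case False
      have "C \<ge> 0" using f[of x] by linarith
      then have "C / g x0 * g x0 \<le> C / g x0 * g x"
        using g(2)[of x0] x0[of x] False by (intro mult_left_mono) auto
      moreover have "C / g x0 * g x0 = C"
        using g(2)[of x0] by simp
      moreover have "C / g x0 * g x \<le> max c (C / g x0) * g x"
        using g(2)[of x] by (intro mult_right_mono) auto
      ultimately show ?thesis using f[of x] by linarith
    qed
  qed
qed

lemma C1_differentiable_on_imp_DERIV_deriv:
  assumes "f C1_differentiable_on UNIV"
  shows "(f has_real_derivative deriv f x) (at x)"
proof -
  obtain D where "(f has_real_derivative D x) (at x)"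
    using assms by (auto simp: C1_differentiable_on_def has_real_derivative_iff_has_vector_derivative)
  then show ?thesis
    using DERIV_imp_deriv by metis
qed

section \<open>Reduction to exponentially decaying single sites\<close>

theorem proposition5p3:
  fixes J :: "'j set"
    and W :: "'j \<Rightarrow> real \<Rightarrow> real"
    and \<epsilon> :: real
    and \<omega> :: "int \<Rightarrow> 'j"
  assumes "finite J"
    and "card J \<ge> 2"
    and "\<And>j. j \<in> J \<Longrightarrow> C2 (W j)"
    and "short_range J W"
    and "\<epsilon> > 0"
    and "\<And>j. j \<in> J \<Longrightarrow>
           deriv (W j) \<in> O[at_infinity](\<lambda>q. real (card J) powr (- (4 + \<epsilon>) * \<bar>q\<bar>))"
    and "\<omega> \<in> UNIV \<rightarrow> J"
  shows "emeasure lborel (closure (critical_values (potential W \<omega>))) = 0"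
proof -
  obtain e C where e: "e > 0" and C: "\<And>j \<alpha> q. j \<in> J \<Longrightarrow> \<alpha> \<in> {0, 1, 2} \<Longrightarrow>
      \<bar>(deriv ^^ \<alpha>) (W j) q\<bar> \<le> C \<alpha> * (1 + q\<^sup>2) powr (- (1 + e) / 2)"
    using assms(4) unfolding short_range_def by metis
  define K where "K = real (card J)"
  \<comment> \<open>The rate for which \<open>K powr (- (4 + \<epsilon>) * |q|)\<close> equals
    \<open>exp (- b * |q|)\<close>.\<close>
  define b where "b = (4 + \<epsilon>) * ln K"
  have K: "K > 1" using assms(2) by (simp add: K_def)
  then have b: "b > 0" "b > 4 * ln K" using assms(5) by (auto simp: b_def)
  have powr_le_1: "(1 + q\<^sup>2) powr (- (1 + e) / 2) \<le> 1" for q :: real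
    using powr_mono2'[of "- (1 + e) / 2" 1 "1 + q\<^sup>2"] e by simp
  have short: "\<bar>(deriv ^^ \<alpha>) (W j) q\<bar> \<le> \<bar>C \<alpha>\<bar> * (1 + q\<^sup>2) powr (- (1 + e) / 2)"
    if "j \<in> J" "\<alpha> \<in> {0, 1, 2}" for j \<alpha> q
    using C[OF that, of q] by (smt (verit) mult_right_mono powr_ge_zero)
  have deriv_W: "(W j has_real_derivative deriv (W j) x) (at x)"
    and deriv_W1: "(deriv (W j) has_real_derivative deriv (deriv (W j)) x) (at x)" if "j \<in> J" for j x
    using assms(3)[OF that] by (auto simp: C2_def intro: C1_differentiable_on_imp_DERIV_deriv)
  have powr_exp: "K powr (- (4 + \<epsilon>) * \<bar>q\<bar>) = exp (- b * \<bar>q\<bar>)" for q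
    using K by (simp add: powr_def b_def algebra_simps)
  have "\<exists>c. \<forall>x. \<bar>deriv (W j) x\<bar> \<le> c * exp (- b * \<bar>x\<bar>)" if j: "j \<in> J" for j
  proof -
    have O: "deriv (W j) \<in> O[at_infinity](\<lambda>q. exp (- b * \<bar>q\<bar>))"
      using assms(6)[OF j] by (simp only: K_def[symmetric] powr_exp)
    have bounded: "\<bar>deriv (W j) x\<bar> \<le> \<bar>C 1\<bar>" for x
      using short[OF j, of 1 x] mult_left_mono[OF powr_le_1[of x], of "\<bar>C 1\<bar>"] by simp
    show ?thesis
      by (rule bigo_at_infinity_bounded[OF O bounded]) (auto intro!: continuous_intros)
  qed
  then obtain c where c: "\<And>j x. j \<in> J \<Longrightarrow> \<bar>deriv (W j) x\<bar> \<le> c j * exp (- b * \<bar>x\<bar>)"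
    by metis
  \<comment> \<open>Finiteness of \<open>J\<close> allows a single constant for all sites.\<close>
  define c1 where "c1 = (\<Sum>j\<in>J. \<bar>c j\<bar>)"
  have c1: "\<bar>deriv (W j) x\<bar> \<le> c1 * exp (- b * \<bar>x\<bar>)" if j: "j \<in> J" for j x
  proof -
    have "c j \<le> c1"
      using member_le_sum[OF j, of "\<lambda>j. \<bar>c j\<bar>"] assms(1) by (simp add: c1_def)
    then show ?thesis
      using c[OF j, of x] by (meson exp_ge_zero mult_right_mono order_trans)
  qed
  \<comment> \<open>The short range bound of order 0 supplies the limit needed to integrate the
    decay of the derivative.\<close>
  have lim: "(W j \<longlongrightarrow> 0) at_infinity" if j: "j \<in> J" for j
  proof (rule Lim_null_comparison)
    show "\<forall>\<^sub>F x in at_infinity. norm (W j x) \<le> \<bar>C 0\<bar> * (1 + x\<^sup>2) powr (- (1 + e) / 2)"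
      using short[OF j, of 0] by simp
    have "filterlim (\<lambda>x::real. (norm x)\<^sup>2) at_top at_infinity"
      by (rule filterlim_pow_at_top[OF _ filterlim_norm_at_top]) simp
    then have "filterlim (\<lambda>x::real. 1 + x\<^sup>2) at_top at_infinity"
      by (intro filterlim_tendsto_add_at_top[OF tendsto_const]) simp
    then show "((\<lambda>x. \<bar>C 0\<bar> * (1 + x\<^sup>2) powr (- (1 + e) / 2)) \<longlongrightarrow> 0) at_infinity"
      by (intro tendsto_mult_right_zero tendsto_neg_powr) (use e in simp_all)
  qed
  \<comment> \<open>\<open>c1\<close> serves the derivative, and \<open>c1 / b\<close>, the result
    of integrating, serves the function itself.\<close>
  define c2 where "c2 = max c1 (c1 / b)"
  have "c1 \<ge> 0" unfolding c1_def by (rule sum_nonneg) simp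
  have c2: "d * exp (- b * \<bar>x\<bar>) \<le> c2 * exp (- b * \<bar>x\<bar>)" if "d \<in> {c1, c1 / b}" for d x
    using that by (intro mult_right_mono) (auto simp: c2_def)
  interpret exp_decaying J W "\<lambda>j. deriv (W j)" "\<lambda>j. deriv (deriv (W j))" b c2 "\<bar>C 2\<bar>" e
  proof
    fix j x assume j: "j \<in> J"
    show "(W j has_real_derivative deriv (W j) x) (at x)"
      and "(deriv (W j) has_real_derivative deriv (deriv (W j)) x) (at x)"
      using deriv_W[OF j] deriv_W1[OF j] .
    show "\<bar>W j x\<bar> \<le> c2 * exp (- b * \<bar>x\<bar>)"
      using exp_decay_of_derivative[OF deriv_W[OF j] c1[OF j] b(1) lim[OF j]] c2 order_trans by blast
    show "\<bar>deriv (W j) x\<bar> \<le> c2 * exp (- b * \<bar>x\<bar>)"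
      using c1[OF j] c2 order_trans by blast
    show "\<bar>deriv (deriv (W j)) x\<bar> \<le> \<bar>C 2\<bar> * (1 + x\<^sup>2) powr (- (1 + e) / 2)"
      using short[OF j, of 2 x] by (simp add: numeral_2_eq_2)
  qed (use b e \<open>c1 \<ge> 0\<close> in \<open>auto simp: c2_def\<close>)
  show ?thesis
    using emeasure_critical_values_eq_0 assms(1,2,7) b(2) by (simp add: K_def)
qed

end
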